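(* Let $T>0$, let $n\ge 1$ be an integer, let $\alpha\in(n-1,n)$ and let $u\in C^{n+1}([0,T])$ be real-valued. Then for $t\in(0,T]$ $${}_0^{TC}D_t^\alpha u(t)={}_0^{C}D_t^\alpha u(t)-\frac{u^{(n)}(0)\,t^{n-\alpha}}{\Gamma(n+1-\alpha)}.$$ In particular, if $u^{(n)}(0)=0$, then ${}_0^{TC}D_t^\alpha u(t)={}_0^{C}D_t^\alpha u(t)$.
   Context: For $n-1<\alpha<n$, the Caputo fractional derivative of order $\alpha$ is $${}_0^{C}D_t^\alpha u(t)=\frac{1}{\Gamma(n-\alpha)}\int_0^t u^{(n)}(s)(t-s)^{n-1-\alpha}\,ds,$$ and the transformative (T-Caputo) derivative of order $\alpha$ is $${}_0^{TC}D_t^\alpha u(t)=\frac{1}{\Gamma(n+1-\alpha)}\int_0^t u^{(n+1)}(s)(t-s)^{n-\alpha}\,ds.$$ Here $\Gamma$ is the Gamma function and $u^{(m)}$ is the $m$-th derivative of $u$. *)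

theory Defs
  imports "HOL-Analysis.Analysis"
begin

(* Derivatives are taken within S, so at the end points of an interval they are one-sided,
   and values of u outside S never matter. *)
primrec nderiv_on :: "real set \<Rightarrow> nat \<Rightarrow> (real \<Rightarrow> real) \<Rightarrow> real \<Rightarrow> real" where
  "nderiv_on S 0 u = u"
| "nderiv_on S (Suc m) u = (\<lambda>x. vector_derivative (nderiv_on S m u) (at x within S))"

definition C_k_on :: "nat \<Rightarrow> (real \<Rightarrow> real) \<Rightarrow> real set \<Rightarrow> bool" where
  "C_k_on k u S \<longleftrightarrow>
     (\<forall>m<k. nderiv_on S m u differentiable_on S) \<and> continuous_on S (nderiv_on S k u)"

(* Both operators are meant for functions on {0..T}, 0 < t \<le> T and n - 1 < \<alpha> < n.
   For \<alpha> > n - 1 the Caputo kernel is singular but Lebesgue integrable at s = t; there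
   0 powr _ = 0, which affects only a null set. *)
definition caputo :: "real \<Rightarrow> nat \<Rightarrow> real \<Rightarrow> (real \<Rightarrow> real) \<Rightarrow> real \<Rightarrow> real" where
  "caputo T n \<alpha> u t =
     1 / Gamma (real n - \<alpha>) *
     (LINT s:{0..t}|lborel. nderiv_on {0..T} n u s * (t - s) powr (real n - 1 - \<alpha>))"

definition t_caputo :: "real \<Rightarrow> nat \<Rightarrow> real \<Rightarrow> (real \<Rightarrow> real) \<Rightarrow> real \<Rightarrow> real" where
  "t_caputo T n \<alpha> u t =
     1 / Gamma (real n + 1 - \<alpha>) *
     (LINT s:{0..t}|lborel. nderiv_on {0..T} (n + 1) u s * (t - s) powr (real n - \<alpha>))"

end

(* The T-Caputo integral is the Caputo integral after one integration by parts. The boundary term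
   at s = t vanishes because n - \<alpha> > 0, the one at s = 0 is the correction, and the factor
   n - \<alpha> is absorbed by the functional equation of Gamma. Since the Caputo kernel is singular at
   s = t, the fundamental theorem of calculus is used in the form that needs derivatives
   only in the interior. *)
theory Submission
  imports Defs
begin

text \<open>The antiderivative \<open>- ((t - s) powr b) / b\<close> stays continuous up to
  \<open>s = t\<close> because \<open>b > 0\<close>, so the kernel has a gauge integral. Being
  nonnegative, it is then absolutely integrable.\<close>

lemma set_integrable_weakly_singular_kernel:
  fixes t b :: real
  assumes "0 \<le> t" "0 < b"
  shows "set_integrable lborel {0..t} (\<lambda>s. (t - s) powr (b - 1))"
proof -
  have "((\<lambda>s. (t - s) powr (b - 1)) has_integral
          - ((t - t) powr b) / b - (- ((t - 0) powr b) / b)) {0..t}"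
  proof (rule fundamental_theorem_of_calculus_interior)
    show "continuous_on {0..t} (\<lambda>s. - ((t - s) powr b) / b)"
      using assms by (intro continuous_intros continuous_on_powr') auto
    show "((\<lambda>s. - ((t - s) powr b) / b) has_vector_derivative (t - s) powr (b - 1)) (at s)"
      if "s \<in> {0<..<t}" for s
      unfolding has_real_derivative_iff_has_vector_derivative[symmetric]
      using that assms by (auto intro!: derivative_eq_intros simp: powr_diff)
  qed (use assms in auto)
  then have "(\<lambda>s. (t - s) powr (b - 1)) absolutely_integrable_on {0..t}"
    by (intro nonnegative_absolutely_integrable_1) auto
  \<comment> \<open>Absolute integrability refers to \<open>lebesgue\<close>, the completion of
    \<open>lborel\<close>; for a Borel measurable integrand the two notions of integrability
    agree.\<close>
  then show ?thesis
    unfolding set_integrable_def by (subst (asm) integrable_completion) auto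
qed

text \<open>On the compact interval \<open>f\<close> is bounded by some \<open>B\<close>, so
  \<open>B * k\<close> dominates the product.\<close>

lemma set_integrable_continuous_mult:
  fixes f k :: "real \<Rightarrow> real"
  assumes "continuous_on {a..b} f" "set_integrable lborel {a..b} k"
  shows "set_integrable lborel {a..b} (\<lambda>s. f s * k s)"
proof -
  have "bounded (f ` {a..b})"
    using assms(1) by (intro compact_imp_bounded compact_continuous_image) auto
  then obtain B where B: "\<And>s. s \<in> {a..b} \<Longrightarrow> \<bar>f s\<bar> \<le> B"
    unfolding bounded_iff real_norm_def by blast
  have f: "(\<lambda>s. indicator {a..b} s *\<^sub>R f s) \<in> borel_measurable lborel"
    using borel_measurable_continuous_on_indicator[OF _ assms(1)] by simp
  have k: "integrable lborel (\<lambda>s. indicator {a..b} s *\<^sub>R k s)"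
    using assms(2) by (simp add: set_integrable_def)
  \<comment> \<open>Each factor carries its own indicator, since \<open>f\<close> and
    \<open>k\<close> are known to be measurable only after restriction to the interval.\<close>
  have "integrable lborel (\<lambda>s. (indicator {a..b} s *\<^sub>R f s) * (indicator {a..b} s *\<^sub>R k s))"
  proof (rule Bochner_Integration.integrable_bound)
    show "integrable lborel (\<lambda>s. B * (indicator {a..b} s *\<^sub>R k s))"
      using k by (rule integrable_mult_right)
    show "(\<lambda>s. (indicator {a..b} s *\<^sub>R f s) * (indicator {a..b} s *\<^sub>R k s)) \<in> borel_measurable lborel"
      using f k by (intro borel_measurable_times) auto
    show "AE s in lborel. norm ((indicator {a..b} s *\<^sub>R f s) * (indicator {a..b} s *\<^sub>R k s))
            \<le> norm (B * (indicator {a..b} s *\<^sub>R k s))"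
      using B by (intro AE_I2) (force simp: indicator_def abs_mult intro!: mult_right_mono)
  qed
  moreover have "(\<lambda>s. (indicator {a..b} s *\<^sub>R f s) * (indicator {a..b} s *\<^sub>R k s))
      = (\<lambda>s. indicator {a..b} s *\<^sub>R (f s * k s))"
    by (auto simp: indicator_def)
  ultimately show ?thesis
    by (simp add: set_integrable_def)
qed

text \<open>This is the product rule for \<open>f s * (t - s) powr b\<close>, integrated. Both terms
  of the derivative are integrable separately, the singular one by the two preceding lemmas, so the
  integral splits.\<close>

lemma weakly_singular_integration_by_parts:
  fixes f f' :: "real \<Rightarrow> real"
  assumes "0 \<le> t" "0 < b"
    and deriv: "\<And>s. s \<in> {0..t} \<Longrightarrow> (f has_vector_derivative f' s) (at s within {0..t})"
    and cont: "continuous_on {0..t} f'"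
  shows "(LINT s:{0..t}|lborel. f' s * (t - s) powr b)
           = b * (LINT s:{0..t}|lborel. f s * (t - s) powr (b - 1)) - f 0 * t powr b"
proof -
  let ?p = "\<lambda>s. f' s * (t - s) powr b" and ?q = "\<lambda>s. f s * (t - s) powr (b - 1)"
  have contf: "continuous_on {0..t} f"
    using deriv by (meson continuous_on_eq_continuous_within has_vector_derivative_continuous)
  have p: "set_integrable lborel {0..t} ?p"
    using assms cont by (intro borel_integrable_atLeastAtMost' continuous_intros continuous_on_powr') auto
  have q: "set_integrable lborel {0..t} ?q"
    using assms contf
    by (intro set_integrable_continuous_mult set_integrable_weakly_singular_kernel)
  \<comment> \<open>The upper boundary term is \<open>0 powr b = 0\<close>, which for
    \<open>b > 0\<close> is also the limit as \<open>s\<close> tends to \<open>t\<close>.\<close>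
  have "((\<lambda>s. ?p s - b * ?q s) has_integral f t * (t - t) powr b - f 0 * (t - 0) powr b) {0..t}"
  proof (rule fundamental_theorem_of_calculus_interior)
    show "continuous_on {0..t} (\<lambda>s. f s * (t - s) powr b)"
      using assms contf by (intro continuous_intros continuous_on_powr') auto
    show "((\<lambda>s. f s * (t - s) powr b) has_vector_derivative ?p s - b * ?q s) (at s)"
      if s: "s \<in> {0<..<t}" for s
    proof -
      have "(f has_real_derivative f' s) (at s)"
        using deriv[of s] s at_within_Icc_at[of 0 s t]
        by (simp add: has_real_derivative_iff_has_vector_derivative)
      then show ?thesis
        unfolding has_real_derivative_iff_has_vector_derivative[symmetric]
        using s by (auto intro!: derivative_eq_intros simp: powr_diff field_simps)
    qed
  qed (use assms in auto)
  \<comment> \<open>The same gauge integral is now computed from the two Lebesgue integrals;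
    uniqueness of its value gives the identity.\<close>
  moreover have "((\<lambda>s. ?p s - b * ?q s) has_integral
      (LINT s:{0..t}|lborel. ?p s) - b * (LINT s:{0..t}|lborel. ?q s)) {0..t}"
    using set_borel_integral_eq_integral[OF p] set_borel_integral_eq_integral[OF q]
    by (intro has_integral_diff has_integral_mult_right) (auto simp: has_integral_iff)
  ultimately show ?thesis
    by (auto dest: has_integral_unique)
qed

theorem lemma4:
  fixes T \<alpha> :: real and n :: nat and u :: "real \<Rightarrow> real"
  assumes "T > 0"
    and "n \<ge> 1"
    and "real n - 1 < \<alpha>" and "\<alpha> < real n"
    and "C_k_on (n + 1) u {0..T}"
  shows "(\<forall>t\<in>{0<..T}. t_caputo T n \<alpha> u t =
            caputo T n \<alpha> u t
              - nderiv_on {0..T} n u 0 * t powr (real n - \<alpha>) / Gamma (real n + 1 - \<alpha>))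
       \<and> (nderiv_on {0..T} n u 0 = 0 \<longrightarrow>
            (\<forall>t\<in>{0<..T}. t_caputo T n \<alpha> u t = caputo T n \<alpha> u t))"
proof -
  define b where "b = real n - \<alpha>"
  have b: "0 < b" and eqs: "real n - \<alpha> = b" "real n + 1 - \<alpha> = b + 1" "real n - 1 - \<alpha> = b - 1"
    using assms by (auto simp: b_def)
  let ?f = "nderiv_on {0..T} n u" and ?f' = "nderiv_on {0..T} (n + 1) u"
  \<comment> \<open>These turn \<open>b / Gamma (b + 1)\<close> into \<open>1 / Gamma b\<close>, the
    Caputo prefactor.\<close>
  have Gamma: "Gamma (b + 1) = b * Gamma b" "Gamma b \<noteq> 0"
    using b less_imp_neq[OF Gamma_real_pos[OF b]] by (auto simp: Gamma_plus1 nonpos_Ints_def)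
  \<comment> \<open>The case \<open>m = n\<close> of \<open>C_k_on (n + 1)\<close> gives
    differentiability, and \<open>?f'\<close> is by definition the derivative of \<open>?f\<close>
    within \<open>{0..T}\<close>.\<close>
  have deriv: "(?f has_vector_derivative ?f' s) (at s within {0..T})" if "s \<in> {0..T}" for s
    using assms(5) that
    by (auto simp: C_k_on_def differentiable_on_def vector_derivative_works[symmetric])
  have cont: "continuous_on {0..T} ?f'"
    using assms(5) by (simp add: C_k_on_def)
  have "t_caputo T n \<alpha> u t = caputo T n \<alpha> u t - ?f 0 * t powr b / Gamma (b + 1)"
    if t: "t \<in> {0<..T}" for t
  proof -
    have "(LINT s:{0..t}|lborel. ?f' s * (t - s) powr b)
            = b * (LINT s:{0..t}|lborel. ?f s * (t - s) powr (b - 1)) - ?f 0 * t powr b"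
    proof (rule weakly_singular_integration_by_parts)
      \<comment> \<open>Derivatives within \<open>{0..T}\<close> restrict to \<open>{0..t}\<close>,
        where the one at \<open>s = t\<close> becomes one-sided.\<close>
      show "(?f has_vector_derivative ?f' s) (at s within {0..t})" if "s \<in> {0..t}" for s
        using deriv[of s] that t by (auto intro: has_vector_derivative_within_subset)
      show "continuous_on {0..t} ?f'"
        using cont t by (auto intro: continuous_on_subset)
    qed (use b t in auto)
    then show ?thesis
      unfolding t_caputo_def caputo_def eqs Gamma using b Gamma(2) by (simp add: field_simps)
  qed
  then show ?thesis
    unfolding eqs by simp
qed

end
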